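(* Let $d\ge1$ be an integer and $\omega_c>0$. Suppose the family $\mathcal{G}_\theta\subset\mathcal{B}_{\omega_c}$ is dense in $\mathcal{B}_{\omega_c}$, and the family $\mathcal{G}_\phi\subset\mathcal{B}_{\omega_c}^{\perp}$ is dense in $\mathcal{B}_{\omega_c}^{\perp}$ (both in the $L^2$ norm). Then, for every $\mathbf{Y}=\mathbf{Y}_{\text{low}}+\mathbf{Y}_{\text{high}}\in L^2(\mathbb{R}^d)$ with $\mathbf{Y}_{\text{low}}\in\mathcal{B}_{\omega_c}$ and $\mathbf{Y}_{\text{high}}\in\mathcal{B}_{\omega_c}^\perp$, $$\inf_{g^{(1)}\in\mathcal{G}_\theta,\;g^{(2)}\in\mathcal{G}_\phi}\bigl\|\mathbf{Y}-g^{(1)}-g^{(2)}\bigr\|_2=0 .$$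
   Context: $\widehat f$ denotes the Fourier transform of $f\in L^2(\mathbb{R}^d)$. The low-frequency subspace is $\mathcal{B}_{\omega_c}=\{f\in L^2(\mathbb{R}^d):\operatorname{supp}\widehat f\subseteq\{\xi\in\mathbb{R}^d:|\xi|\le\omega_c\}\}$, and $\mathcal{B}_{\omega_c}^\perp$ is its orthogonal complement in $L^2(\mathbb{R}^d)$. The elements of $\mathcal{G}_\theta$ and $\mathcal{G}_\phi$ are the outputs (generations) $g^{(1)}_\theta$ and $g^{(2)}_\phi$ of the first (low-frequency) and second (high-frequency) model, respectively. *)

theory Defs
  imports "HOL-Analysis.Analysis"
begin

text \<open>
  Elements of \<open>L\<^sup>2(\<real>\<^sup>d)\<close> are handled through complex-valued Borel representatives on \<open>real ^ 'n\<close>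
  (with \<open>d = CARD('n)\<close>), so equality in \<open>L\<^sup>2\<close> is equality almost everywhere.
\<close>

definition L2_space :: "(real ^ 'n \<Rightarrow> complex) set" where
  "L2_space = {f \<in> borel_measurable lborel. integrable lborel (\<lambda>x. (cmod (f x))\<^sup>2)}"

definition L2_inner :: "(real ^ 'n \<Rightarrow> complex) \<Rightarrow> (real ^ 'n \<Rightarrow> complex) \<Rightarrow> complex" where
  "L2_inner f g = (LINT x|lborel. f x * cnj (g x))"

text \<open>Only meaningful on \<open>L2_space\<close>: outside it the Bochner integral may default to \<open>0\<close>.\<close>

definition L2_norm :: "(real ^ 'n \<Rightarrow> complex) \<Rightarrow> real" where
  "L2_norm f = sqrt (LINT x|lborel. (cmod (f x))\<^sup>2)"

definition L2_dense :: "(real ^ 'n \<Rightarrow> complex) set \<Rightarrow> (real ^ 'n \<Rightarrow> complex) set \<Rightarrow> bool" where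
  "L2_dense G V \<longleftrightarrow>
     G \<subseteq> V \<and> (\<forall>f\<in>V. \<forall>\<epsilon>>0. \<exists>g\<in>G. L2_norm (\<lambda>x. f x - g x) < \<epsilon>)"

definition L2_orthogonal_complement ::
    "(real ^ 'n \<Rightarrow> complex) set \<Rightarrow> (real ^ 'n \<Rightarrow> complex) set" where
  "L2_orthogonal_complement V = {f \<in> L2_space. \<forall>g\<in>V. L2_inner f g = 0}"

definition fourier_integral :: "(real ^ 'n \<Rightarrow> complex) \<Rightarrow> real ^ 'n \<Rightarrow> complex" where
  "fourier_integral f \<xi> = (LINT x|lborel. cis (- 2 * pi * (x \<bullet> \<xi>)) * f x)"

text \<open>
  The integral above need not exist for \<open>f \<in> L\<^sup>2\<close>. The Fourier(--Plancherel) transform of \<open>f\<close> is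
  the \<open>L\<^sup>2\<close> limit of the Fourier integrals of the truncations of \<open>f\<close> to balls (which are in \<open>L\<^sup>1\<close>).
  By Plancherel's theorem the limit exists for every \<open>f \<in> L\<^sup>2\<close>; it is unique almost everywhere,
  and the choice operator merely picks a representative. Convergence is phrased with the
  nonnegative integral, which does not default to \<open>0\<close> on non-integrable functions.
\<close>

definition is_fourier_L2 :: "(real ^ 'n \<Rightarrow> complex) \<Rightarrow> (real ^ 'n \<Rightarrow> complex) \<Rightarrow> bool" where
  "is_fourier_L2 f h \<longleftrightarrow> h \<in> L2_space \<and>
     (\<lambda>k::nat. \<integral>\<^sup>+\<xi>. ennreal ((cmod (fourier_integral
         (\<lambda>x. indicator (cball 0 (real k)) x * f x) \<xi> - h \<xi>))\<^sup>2) \<partial>lborel) \<longlonglongrightarrow> 0"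

definition fourier_L2 :: "(real ^ 'n \<Rightarrow> complex) \<Rightarrow> real ^ 'n \<Rightarrow> complex" where
  "fourier_L2 f = (SOME h. is_fourier_L2 f h)"

text \<open>
  The support of an \<open>L\<^sup>2\<close> element: the complement of the largest open set on which it vanishes
  almost everywhere. It does not depend on the representative.
\<close>

definition ess_support :: "(real ^ 'n \<Rightarrow> complex) \<Rightarrow> (real ^ 'n) set" where
  "ess_support f = - \<Union>{U. open U \<and> (AE x in lborel. x \<in> U \<longrightarrow> f x = 0)}"

definition low_freq_space :: "real \<Rightarrow> (real ^ 'n \<Rightarrow> complex) set" where
  "low_freq_space \<omega> = {f \<in> L2_space. ess_support (fourier_L2 f) \<subseteq> {\<xi>. norm \<xi> \<le> \<omega>}}"

end

theory Submission
  imports Defs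
begin

text \<open>The error splits as \<open>Y - g1 - g2 = (Y_low - g1) + (Y_high - g2)\<close> almost
  everywhere, and by density each summand can be made small on its own, independently of the other.
  The norm of the sum is then controlled by a squared triangle inequality in L2
  (\<open>L2_norm_add_squared_le\<close>), which comes from the pointwise bound |a + b|^2 \<le>
  2|a|^2 + 2|b|^2. So errors below every positive \<epsilon> occur, and as norms are nonnegative the
  infimum is 0.\<close>

lemma norm_add_squared_le:
  fixes a b :: "'a::real_normed_vector"
  shows "(norm (a + b))\<^sup>2 \<le> 2 * (norm a)\<^sup>2 + 2 * (norm b)\<^sup>2"
proof -
  have "(norm (a + b))\<^sup>2 \<le> (norm a + norm b)\<^sup>2"
    by (intro power_mono norm_triangle_ineq norm_ge_zero)
  also have "\<dots> \<le> 2 * (norm a)\<^sup>2 + 2 * (norm b)\<^sup>2"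
    using sum_squares_bound[of "norm a" "norm b"] by (simp add: power2_sum)
  finally show ?thesis .
qed

text \<open>Puts the two residuals \<open>Y_low - g1\<close> and \<open>Y_high - g2\<close> in L2,
  so that the norm estimate applies to them.\<close>

lemma L2_space_diff:
  assumes "f \<in> L2_space" "g \<in> L2_space"
  shows "(\<lambda>x. f x - g x) \<in> L2_space"
proof -
  have [measurable]: "f \<in> borel_measurable lborel" "g \<in> borel_measurable lborel"
    using assms by (auto simp: L2_space_def)
  have "integrable lborel (\<lambda>x. 2 * (cmod (f x))\<^sup>2 + 2 * (cmod (g x))\<^sup>2)"
    using assms by (auto simp: L2_space_def)
  then have "integrable lborel (\<lambda>x. (cmod (f x - g x))\<^sup>2)"
  proof (rule Bochner_Integration.integrable_bound)
    show "AE x in lborel. norm ((cmod (f x - g x))\<^sup>2)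
        \<le> norm (2 * (cmod (f x))\<^sup>2 + 2 * (cmod (g x))\<^sup>2)"
      using norm_add_squared_le[of "f x" "- g x" for x] by simp
  qed measurable
  then show ?thesis
    by (simp add: L2_space_def)
qed

lemma L2_norm_nonneg: "0 \<le> L2_norm f"
  by (simp add: L2_norm_def)

text \<open>Needed because the decomposition of \<open>Y\<close> holds only almost everywhere
  between representatives.\<close>

lemma L2_norm_cong_AE:
  assumes [measurable]: "f \<in> borel_measurable lborel" "g \<in> borel_measurable lborel"
    and "AE x in lborel. f x = g x"
  shows "L2_norm f = L2_norm g"
proof -
  have "(LINT x|lborel. (cmod (f x))\<^sup>2) = (LINT x|lborel. (cmod (g x))\<^sup>2)"
    by (rule integral_cong_AE) (use assms(3) in auto)
  then show ?thesis
    by (simp add: L2_norm_def)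
qed

text \<open>Stands in for Minkowski's inequality. Nothing is lost when both norms have the same
  bound, which is how it is applied.\<close>

lemma L2_norm_add_squared_le:
  assumes "f \<in> L2_space" "g \<in> L2_space"
  shows "(L2_norm (\<lambda>x. f x + g x))\<^sup>2 \<le> 2 * (L2_norm f)\<^sup>2 + 2 * (L2_norm g)\<^sup>2"
proof -
  have int: "integrable lborel (\<lambda>x. (cmod (f x))\<^sup>2)" "integrable lborel (\<lambda>x. (cmod (g x))\<^sup>2)"
    using assms by (auto simp: L2_space_def)
  have "(LINT x|lborel. (cmod (f x + g x))\<^sup>2)
      \<le> (LINT x|lborel. 2 * (cmod (f x))\<^sup>2 + 2 * (cmod (g x))\<^sup>2)"
    \<comment> \<open>This rule asks for integrability of the nonnegative majorant only; a
      non-integrable left side would default to 0.\<close>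
    by (rule integral_mono') (use int norm_add_squared_le in auto)
  also have "\<dots> = 2 * (LINT x|lborel. (cmod (f x))\<^sup>2) + 2 * (LINT x|lborel. (cmod (g x))\<^sup>2)"
    using int by simp
  finally show ?thesis
    by (simp add: L2_norm_def)
qed

theorem corollary2:
  fixes \<omega>\<^sub>c :: real
    and G\<^sub>\<theta> G\<^sub>\<phi> :: "(real ^ 'n \<Rightarrow> complex) set"
    and Y Y_low Y_high :: "real ^ 'n \<Rightarrow> complex"
  assumes "\<omega>\<^sub>c > 0"
    and "G\<^sub>\<theta> \<subseteq> low_freq_space \<omega>\<^sub>c"
    and "L2_dense G\<^sub>\<theta> (low_freq_space \<omega>\<^sub>c)"
    and "G\<^sub>\<phi> \<subseteq> L2_orthogonal_complement (low_freq_space \<omega>\<^sub>c)"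
    and "L2_dense G\<^sub>\<phi> (L2_orthogonal_complement (low_freq_space \<omega>\<^sub>c))"
    and "Y \<in> L2_space"
    and "Y_low \<in> low_freq_space \<omega>\<^sub>c"
    and "Y_high \<in> L2_orthogonal_complement (low_freq_space \<omega>\<^sub>c)"
    and "AE x in lborel. Y x = Y_low x + Y_high x"
  shows "(INF (g1, g2) \<in> G\<^sub>\<theta> \<times> G\<^sub>\<phi>. L2_norm (\<lambda>x. Y x - g1 x - g2 x)) = 0"
proof -
  let ?N = "\<lambda>(g1, g2). L2_norm (\<lambda>x. Y x - g1 x - g2 x)"
  have approx: "\<exists>p\<in>G\<^sub>\<theta> \<times> G\<^sub>\<phi>. ?N p < \<epsilon>" if "\<epsilon> > 0" for \<epsilon> :: real
  proof -
    \<comment> \<open>Two errors below \<epsilon>/2 suffice, since 2(\<epsilon>/2)^2 +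
      2(\<epsilon>/2)^2 = \<epsilon>^2.\<close>
    obtain g1 where g1: "g1 \<in> G\<^sub>\<theta>" "L2_norm (\<lambda>x. Y_low x - g1 x) < \<epsilon> / 2"
      using assms(3,7) half_gt_zero[OF \<open>\<epsilon> > 0\<close>] unfolding L2_dense_def by blast
    obtain g2 where g2: "g2 \<in> G\<^sub>\<phi>" "L2_norm (\<lambda>x. Y_high x - g2 x) < \<epsilon> / 2"
      using assms(5,8) half_gt_zero[OF \<open>\<epsilon> > 0\<close>] unfolding L2_dense_def by blast
    have L2: "Y_low \<in> L2_space" "g1 \<in> L2_space" "Y_high \<in> L2_space" "g2 \<in> L2_space"
      using assms(2,4,7,8) g1(1) g2(1)
      by (auto simp: low_freq_space_def L2_orthogonal_complement_def)
    have [measurable]: "Y \<in> borel_measurable lborel" "Y_low \<in> borel_measurable lborel"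
      "Y_high \<in> borel_measurable lborel" "g1 \<in> borel_measurable lborel"
      "g2 \<in> borel_measurable lborel"
      using assms(6) L2 by (auto simp: L2_space_def)
    have "?N (g1, g2) = L2_norm (\<lambda>x. (Y_low x - g1 x) + (Y_high x - g2 x))"
      unfolding prod.case by (rule L2_norm_cong_AE) (use assms(9) in auto)
    then have "(?N (g1, g2))\<^sup>2
        \<le> 2 * (L2_norm (\<lambda>x. Y_low x - g1 x))\<^sup>2 + 2 * (L2_norm (\<lambda>x. Y_high x - g2 x))\<^sup>2"
      using L2_norm_add_squared_le[OF L2_space_diff[OF L2(1,2)] L2_space_diff[OF L2(3,4)]] by simp
    also have "\<dots> < 2 * (\<epsilon> / 2)\<^sup>2 + 2 * (\<epsilon> / 2)\<^sup>2"
      using g1(2) g2(2) by (intro add_strict_mono mult_strict_left_mono power_strict_mono)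
        (auto simp: L2_norm_nonneg)
    also have "\<dots> = \<epsilon>\<^sup>2"
      by (simp add: power2_eq_square)
    finally have "?N (g1, g2) < \<epsilon>"
      using \<open>\<epsilon> > 0\<close> by (simp add: power_less_imp_less_base)
    with g1(1) g2(1) show ?thesis
      by blast
  qed
  \<comment> \<open>The infimum of a set of reals is meaningful only if the set is nonempty and
    bounded below; both are secured before it is estimated.\<close>
  have bdd: "bdd_below (?N ` (G\<^sub>\<theta> \<times> G\<^sub>\<phi>))"
    by (rule bdd_belowI[of _ 0]) (auto simp: L2_norm_nonneg)
  \<comment> \<open>Any positive tolerance yields a member; 1 is arbitrary.\<close>
  have ne: "G\<^sub>\<theta> \<times> G\<^sub>\<phi> \<noteq> {}"
    using approx[of 1] by auto
  show ?thesis
  proof (rule antisym)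
    show "(INF p\<in>G\<^sub>\<theta> \<times> G\<^sub>\<phi>. ?N p) \<le> 0"
    proof (rule field_le_epsilon)
      fix \<epsilon> :: real assume "\<epsilon> > 0"
      from approx[OF this] obtain p where "p \<in> G\<^sub>\<theta> \<times> G\<^sub>\<phi>" "?N p < \<epsilon>" ..
      then show "(INF p\<in>G\<^sub>\<theta> \<times> G\<^sub>\<phi>. ?N p) \<le> 0 + \<epsilon>"
        using cINF_lower[OF bdd] by force
    qed
    show "0 \<le> (INF p\<in>G\<^sub>\<theta> \<times> G\<^sub>\<phi>. ?N p)"
      by (rule cINF_greatest[OF ne]) (auto simp: L2_norm_nonneg)
  qed
qed

end
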